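(* Let $m\ge 1$ be an integer and let $(X,\varphi)$ be a minimal topological dynamical system which is an $m$:1 topomorphic extension of its maximal equicontinuous factor $(Y,\psi)$. Then $(X,\varphi)$ is mean $(m+1)$-equicontinuous.
   Context: A topological dynamical system (tds) $(X,\varphi)$ is a compact metric space $(X,d)$ together with a homeomorphism $\varphi:X\to X$. Its maximal equicontinuous factor (MEF) is the largest topological factor $(Y,\psi)$ of $(X,\varphi)$ that is equicontinuous (every equicontinuous factor of $(X,\varphi)$ is a factor of it); $\pi:X\to Y$ denotes the corresponding (continuous, surjective) factor map, $\pi\circ\varphi=\psi\circ\pi$. All measures are Borel probability measures. $m$:1 topomorphic extension: For $n\in\mathbb{N}$ and a map $\gamma=(\gamma_1,\ldots,\gamma_n):Y\to X^n$ with $\pi(\gamma_i(y))=y$ for all $y\in Y$ and $i=1,\ldots,n$, put $\Gamma=\{\gamma_i(y) : y\in Y,\ i=1,\ldots,n\}$. The system $(X,\varphi)$ is an $m$:1 topomorphic extension (of its MEF) if $m$ is the least integer $n\ge 1$ for which there exists a (Borel) measurable map $\gamma=(\gamma_1,\ldots,\gamma_n):Y\to X^n$ with $\pi(\gamma_i(y))=y$ for all $y\in Y$ and $i=1,\ldots,n$ such that $\mu(\Gamma)=1$ for every $\varphi$-invariant measure $\mu$ on $X$. Mean $k$-equicontinuity ($k\geq 2$): For $x_1,\ldots,x_k\in X$ let $$\mathrm{D}_k(x_1,\ldots,x_k)=\min_{1\le i<j\le k} d(x_i,x_j),\qquad \mathrm{D}_k^{\max}(x_1,\ldots,x_k)=\max_{1\le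 i<j\le k} d(x_i,x_j),$$ $$\overline{\mathrm{D}}_k^{\varphi}(x_1,\ldots,x_k)=\limsup_{n\to\infty}\frac1n\sum_{i=0}^{n-1}\mathrm{D}_k(\varphi^i(x_1),\ldots,\varphi^i(x_k)).$$ $(X,\varphi)$ is mean $k$-equicontinuous if for all $\varepsilon>0$ there is $\delta>0$ such that $\mathrm{D}_k^{\max}(x_1,\ldots,x_k)<\delta$ implies $\overline{\mathrm{D}}_k^{\varphi}(x_1,\ldots,x_k)<\varepsilon$. *)

theory Defs
  imports "HOL-Probability.Probability"
begin

definition tds :: "'a::metric_space set \<Rightarrow> ('a \<Rightarrow> 'a) \<Rightarrow> bool" where
  "tds X \<phi> \<longleftrightarrow> compact X \<and> (\<exists>\<phi>'. homeomorphism X X \<phi> \<phi>')"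

definition minimal_tds :: "'a::metric_space set \<Rightarrow> ('a \<Rightarrow> 'a) \<Rightarrow> bool" where
  "minimal_tds X \<phi> \<longleftrightarrow> tds X \<phi> \<and> (\<forall>A. A \<subseteq> X \<and> closed A \<and> \<phi> ` A = A \<longrightarrow> A = {} \<or> A = X)"

text \<open>For a homeomorphism of a compact metric space, equicontinuity of the forward iterates is
  the same as equicontinuity of all iterates, and it may be stated uniformly.\<close>

definition equicontinuous_tds :: "'a::metric_space set \<Rightarrow> ('a \<Rightarrow> 'a) \<Rightarrow> bool" where
  "equicontinuous_tds X \<phi> \<longleftrightarrow> tds X \<phi> \<and>
     (\<forall>\<epsilon>>0. \<exists>\<delta>>0. \<forall>x\<in>X. \<forall>y\<in>X. dist x y < \<delta> \<longrightarrow>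
        (\<forall>n::nat. dist ((\<phi> ^^ n) x) ((\<phi> ^^ n) y) < \<epsilon>))"

definition factor_map ::
  "'a::metric_space set \<Rightarrow> ('a \<Rightarrow> 'a) \<Rightarrow> 'b::metric_space set \<Rightarrow> ('b \<Rightarrow> 'b) \<Rightarrow> ('a \<Rightarrow> 'b) \<Rightarrow> bool" where
  "factor_map X \<phi> Y \<psi> \<pi> \<longleftrightarrow>
     continuous_on X \<pi> \<and> \<pi> ` X = Y \<and> (\<forall>x\<in>X. \<pi> (\<phi> x) = \<psi> (\<pi> x))"

text \<open>HOL cannot quantify over all types inside a formula, so the competing equicontinuous factors
  are taken with phase space inside the fixed metric space of real sequences (product topology).
  Every compact metric space embeds there and equicontinuity is invariant under conjugacy, so
  nothing is lost: the lemma \<open>mef_universal\<close> below derives maximality among the equicontinuous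
  factors living in an arbitrary metric space.\<close>

definition maximal_equicontinuous_factor ::
  "'a::metric_space set \<Rightarrow> ('a \<Rightarrow> 'a) \<Rightarrow> 'b::metric_space set \<Rightarrow> ('b \<Rightarrow> 'b) \<Rightarrow> ('a \<Rightarrow> 'b) \<Rightarrow> bool" where
  "maximal_equicontinuous_factor X \<phi> Y \<psi> \<pi> \<longleftrightarrow>
     equicontinuous_tds Y \<psi> \<and> factor_map X \<phi> Y \<psi> \<pi> \<and>
     (\<forall>(Z :: (nat \<Rightarrow> real) set) \<zeta> p.
        equicontinuous_tds Z \<zeta> \<and> factor_map X \<phi> Z \<zeta> p \<longrightarrow> (\<exists>q. factor_map Y \<psi> Z \<zeta> q))"

definition invariant_measure :: "'a::metric_space set \<Rightarrow> ('a \<Rightarrow> 'a) \<Rightarrow> 'a measure \<Rightarrow> bool" where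
  "invariant_measure X \<phi> \<mu> \<longleftrightarrow>
     prob_space \<mu> \<and> sets \<mu> = sets (restrict_space borel X) \<and> distr \<mu> \<mu> \<phi> = \<mu>"

text \<open>The product sigma-algebra on \<open>X\<close> to the power \<open>n\<close> is its Borel sigma-algebra, as \<open>X\<close> is
  compact metric.  The condition on the image says in particular that the image is measurable,
  since non-measurable sets have measure 0 in this library.\<close>

definition topomorphic_section ::
  "nat \<Rightarrow> 'a::metric_space set \<Rightarrow> ('a \<Rightarrow> 'a) \<Rightarrow> 'b::metric_space set \<Rightarrow> ('a \<Rightarrow> 'b)
    \<Rightarrow> ('b \<Rightarrow> nat \<Rightarrow> 'a) \<Rightarrow> bool" where
  "topomorphic_section n X \<phi> Y \<pi> \<gamma> \<longleftrightarrow>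
     \<gamma> \<in> restrict_space borel Y \<rightarrow>\<^sub>M (\<Pi>\<^sub>M i\<in>{1..n}. restrict_space borel X) \<and>
     (\<forall>y\<in>Y. \<forall>i\<in>{1..n}. \<pi> (\<gamma> y i) = y) \<and>
     (\<forall>\<mu>. invariant_measure X \<phi> \<mu> \<longrightarrow> measure \<mu> {\<gamma> y i | y i. y \<in> Y \<and> i \<in> {1..n}} = 1)"

definition topomorphic_extension ::
  "nat \<Rightarrow> 'a::metric_space set \<Rightarrow> ('a \<Rightarrow> 'a) \<Rightarrow> 'b::metric_space set \<Rightarrow> ('a \<Rightarrow> 'b) \<Rightarrow> bool" where
  "topomorphic_extension m X \<phi> Y \<pi> \<longleftrightarrow>
     m \<ge> 1 \<and> (\<exists>\<gamma>. topomorphic_section m X \<phi> Y \<pi> \<gamma>) \<and>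
     (\<forall>n. 1 \<le> n \<and> n < m \<longrightarrow> \<not> (\<exists>\<gamma>. topomorphic_section n X \<phi> Y \<pi> \<gamma>))"

text \<open>Tuples are functions on \<open>{1..k}\<close>; the minimum and maximum below are only meaningful for
  \<open>k \<ge> 2\<close>, when the set of pairs is nonempty.\<close>

definition D_min :: "nat \<Rightarrow> (nat \<Rightarrow> 'a::metric_space) \<Rightarrow> real" where
  "D_min k x = Min {dist (x i) (x j) | i j. 1 \<le> i \<and> i < j \<and> j \<le> k}"

definition D_max :: "nat \<Rightarrow> (nat \<Rightarrow> 'a::metric_space) \<Rightarrow> real" where
  "D_max k x = Max {dist (x i) (x j) | i j. 1 \<le> i \<and> i < j \<and> j \<le> k}"

definition D_mean :: "nat \<Rightarrow> ('a::metric_space \<Rightarrow> 'a) \<Rightarrow> (nat \<Rightarrow> 'a) \<Rightarrow> ereal" where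
  "D_mean k \<phi> x = limsup (\<lambda>n. ereal (1 / real n * (\<Sum>i<n. D_min k (\<lambda>j. (\<phi> ^^ i) (x j)))))"

definition mean_equicontinuous :: "nat \<Rightarrow> 'a::metric_space set \<Rightarrow> ('a \<Rightarrow> 'a) \<Rightarrow> bool" where
  "mean_equicontinuous k X \<phi> \<longleftrightarrow>
     (\<forall>\<epsilon>>0. \<exists>\<delta>>0. \<forall>x. (\<forall>i\<in>{1..k}. x i \<in> X) \<and> D_max k x < \<delta> \<longrightarrow> D_mean k \<phi> x < ereal \<epsilon>)"

lemma compact_embeds_sequences:
  fixes Z :: "'c::metric_space set"
  assumes "compact Z"
  obtains e :: "'c \<Rightarrow> nat \<Rightarrow> real" and e' where "homeomorphism Z (e ` Z) e e'"
proof (cases "Z = {}")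
  case True
  then show thesis using that[of "\<lambda>_ _. 0"] by (auto simp: homeomorphism_def)
next
  case False
  have "\<forall>n::nat. \<exists>K. finite K \<and> K \<subseteq> Z \<and> Z \<subseteq> (\<Union>x\<in>K. ball x (inverse (Suc n)))"
    using seq_compact_imp_totally_bounded[OF assms[unfolded compact_eq_seq_compact_metric]]
    by (meson inverse_positive_iff_positive of_nat_0_less_iff zero_less_Suc)
  then obtain K where K: "\<And>n::nat. finite (K n)" "\<And>n. K n \<subseteq> Z"
    "\<And>n::nat. Z \<subseteq> (\<Union>x\<in>K n. ball x (inverse (Suc n)))" by metis
  define Q where "Q = (\<Union>n. K n)"
  have "countable Q" unfolding Q_def using K(1) by (auto intro: countable_finite)
  moreover have "Q \<noteq> {}" using K(3)[of 0] False by (auto simp: Q_def)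
  ultimately obtain q :: "nat \<Rightarrow> 'c" where q: "range q = Q"
    by (metis uncountable_def)
  define e where "e = (\<lambda>z n. dist z (q n))"
  have "continuous_on Z e" unfolding e_def
    by (intro continuous_on_coordinatewise_then_product continuous_intros)
  moreover have "inj_on e Z"
  proof (rule inj_onI, rule ccontr)
    fix x y assume xy: "x \<in> Z" "y \<in> Z" "e x = e y" "x \<noteq> y"
    then obtain n where n: "inverse (real (Suc n)) < dist x y / 2"
      using reals_Archimedean[of "dist x y / 2"] by auto
    obtain c where c: "c \<in> K n" "dist c x < inverse (Suc n)" using K(3)[of n] xy by auto
    then obtain i where "q i = c"
      using q unfolding Q_def by (metis UNIV_I UN_I rangeE)
    then have "dist x c = dist y c" using fun_cong[OF xy(3), of i] by (simp add: e_def)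
    then have "dist x y \<le> 2 * dist c x" by (metis dist_commute dist_triangle2 mult_2)
    then show False using c n by linarith
  qed
  ultimately show thesis using homeomorphism_compact[OF assms] that by metis
qed

lemma mef_universal:
  fixes Z :: "'c::metric_space set"
  assumes mef: "maximal_equicontinuous_factor X \<phi> Y \<psi> \<pi>"
    and eq: "equicontinuous_tds Z \<zeta>" and p: "factor_map X \<phi> Z \<zeta> p"
  shows "\<exists>q. factor_map Y \<psi> Z \<zeta> q"
proof -
  from eq obtain \<zeta>' where cZ: "compact Z" and \<zeta>: "homeomorphism Z Z \<zeta> \<zeta>'"
    by (auto simp: equicontinuous_tds_def tds_def)
  obtain e :: "'c \<Rightarrow> nat \<Rightarrow> real" and e' where e: "homeomorphism Z (e ` Z) e e'"
    using compact_embeds_sequences[OF cZ] by metis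
  have e': "homeomorphism (e ` Z) Z e' e" using e by (simp add: homeomorphism_symD)
  have ce: "compact (e ` Z)" using cZ e by (auto simp: homeomorphism_def intro: compact_continuous_image)
  have inv: "\<And>z. z \<in> Z \<Longrightarrow> e' (e z) = z" using e by (auto simp: homeomorphism_def)
  have \<zeta>Z: "\<And>z. z \<in> Z \<Longrightarrow> \<zeta> z \<in> Z" using \<zeta> by (auto simp: homeomorphism_def)
  define \<eta> where "\<eta> = e \<circ> (\<zeta> \<circ> e')"
  have h: "homeomorphism (e ` Z) (e ` Z) \<eta> ((e \<circ> \<zeta>') \<circ> e')"
    unfolding \<eta>_def using homeomorphism_compose[OF homeomorphism_compose[OF e' \<zeta>] e]
    by (simp add: comp_assoc)
  have it: "(\<eta> ^^ n) (e z) = e ((\<zeta> ^^ n) z) \<and> (\<zeta> ^^ n) z \<in> Z" if "z \<in> Z" for n z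
    by (induction n) (use that in \<open>auto simp: \<eta>_def inv \<zeta>Z\<close>)
  have "equicontinuous_tds (e ` Z) \<eta>"
    unfolding equicontinuous_tds_def
  proof (intro conjI allI impI)
    show "tds (e ` Z) \<eta>" using h ce by (auto simp: tds_def)
    fix \<epsilon> :: real assume "\<epsilon> > 0"
    have "uniformly_continuous_on Z e" "uniformly_continuous_on (e ` Z) e'"
      using e ce cZ by (auto simp: homeomorphism_def intro: compact_uniformly_continuous)
    then obtain d1 where d1: "d1 > 0" "\<And>x y. x \<in> Z \<Longrightarrow> y \<in> Z \<Longrightarrow> dist x y < d1 \<Longrightarrow> dist (e x) (e y) < \<epsilon>"
      unfolding uniformly_continuous_on_def using \<open>\<epsilon> > 0\<close> by metis
    obtain d2 where d2: "d2 > 0" "\<And>x y n. x \<in> Z \<Longrightarrow> y \<in> Z \<Longrightarrow> dist x y < d2 \<Longrightarrow>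
        dist ((\<zeta> ^^ n) x) ((\<zeta> ^^ n) y) < d1"
      using eq d1(1) unfolding equicontinuous_tds_def by metis
    obtain d3 where d3: "d3 > 0" "\<And>x y. x \<in> e ` Z \<Longrightarrow> y \<in> e ` Z \<Longrightarrow> dist x y < d3 \<Longrightarrow> dist (e' x) (e' y) < d2"
      using \<open>uniformly_continuous_on (e ` Z) e'\<close> d2(1) unfolding uniformly_continuous_on_def by metis
    have "dist ((\<eta> ^^ n) x) ((\<eta> ^^ n) y) < \<epsilon>"
      if xy: "x \<in> e ` Z" "y \<in> e ` Z" "dist x y < d3" for x y n
    proof -
      obtain a b where ab: "a \<in> Z" "b \<in> Z" "x = e a" "y = e b" using xy by blast
      then have "dist a b < d2" using d3(2)[OF that] by (simp add: inv)
      then show ?thesis using d1(2) d2(2) it ab by metis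
    qed
    then show "\<exists>\<delta>>0. \<forall>x\<in>e ` Z. \<forall>y\<in>e ` Z. dist x y < \<delta> \<longrightarrow>
        (\<forall>n. dist ((\<eta> ^^ n) x) ((\<eta> ^^ n) y) < \<epsilon>)" using d3(1) by metis
  qed
  moreover have pX: "p x \<in> Z" if "x \<in> X" for x using p that by (auto simp: factor_map_def)
  have "factor_map X \<phi> (e ` Z) \<eta> (e \<circ> p)"
    using p e pX unfolding factor_map_def homeomorphism_def
    by (auto simp: \<eta>_def inv intro: continuous_on_compose[unfolded o_def])
  ultimately obtain q where q: "factor_map Y \<psi> (e ` Z) \<eta> q"
    using mef unfolding maximal_equicontinuous_factor_def by blast
  have "e' (q (\<psi> y)) = \<zeta> (e' (q y))" if "y \<in> Y" for y
  proof -
    have "q y \<in> e ` Z" using q that by (auto simp: factor_map_def)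
    then have "e' (q y) \<in> Z" using inv by auto
    then show ?thesis using q that by (auto simp: factor_map_def \<eta>_def inv \<zeta>Z)
  qed
  moreover have "continuous_on Y (e' \<circ> q)" "(e' \<circ> q) ` Y = Z"
    using q e unfolding factor_map_def homeomorphism_def
    by (metis continuous_on_compose, metis image_comp)
  ultimately show ?thesis unfolding factor_map_def by (intro exI[of _ "e' \<circ> q"]) auto
qed

end

theory Submission
  imports Defs
begin

text \<open>
  Suppose mean \<open>(m + 1)\<close>-equicontinuity fails for some \<open>\<epsilon>\<close>.  Then there are \<open>(m + 1)\<close>-tuples of
  points of \<open>X\<close>, of diameter tending to 0, along whose orbits the average of \<open>D_min\<close> exceeds
  \<open>\<epsilon> / 2\<close> at arbitrarily late times.  The empirical measures of these orbits, up to such times,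
  are probability measures on a power of \<open>X\<close>.  Let \<open>M\<close> be a weak limit of them.  As the times tend
  to infinity, \<open>M\<close> is invariant under the product map, so each of its coordinate marginals is
  \<open>\<phi>\<close>-invariant (\<open>orbit_averages_weak_limit\<close>); and since \<open>D_min\<close> is continuous, its \<open>M\<close>-integral
  is at least \<open>\<epsilon> / 2\<close>.

  On the other hand \<open>D_min\<close> vanishes \<open>M\<close>-almost everywhere.  As the factor is equicontinuous, the
  projections to \<open>Y\<close> of the orbits of nearby points stay uniformly close, so in the limit almost
  every tuple lies in a single fibre of \<open>\<pi>\<close>.  The marginals being invariant, almost every tuple has
  all its entries in the union \<open>\<Gamma>\<close> of the images of the sections.  Now \<open>\<Gamma>\<close> meets a fibre in at
  most \<open>m\<close> points, so two of the \<open>m + 1\<close> entries coincide.  This contradiction is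
  \<open>topomorphic_section_imp_mean_equicontinuous\<close>.

  The analytic input is the weak sequential compactness of probability measures on a compact metric
  space (\<open>compact_pmf_weak_limit\<close>).  It is reduced to Helly's selection theorem on the real line:
  every compact metric space is a continuous image of a compact set of reals, discrete
  measures can be lifted along this map, and a weak limit of the lifts can be pushed forward.
\<close>

section \<open>Compact metric spaces as continuous images of compact sets of reals\<close>

text \<open>Balls of radius \<open>1 / (n + 1)\<close> around finite nets, for all \<open>n\<close>, listed in one sequence.  Knowing
  in which of the first sets a point lies then locates the point up to \<open>\<epsilon>\<close>.\<close>

lemma separating_sequence_of_sets:
  fixes Z :: "'c::metric_space set"
  assumes "compact Z"
  obtains U :: "nat \<Rightarrow> 'c set"
  where "\<And>\<epsilon>. 0 < \<epsilon> \<Longrightarrow> \<exists>n. \<forall>z\<in>Z. \<exists>i<n. z \<in> U i \<and> (\<forall>w\<in>U i. dist z w < \<epsilon>)"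
proof -
  have "\<forall>n::nat. \<exists>K. finite K \<and> K \<subseteq> Z \<and> Z \<subseteq> (\<Union>x\<in>K. ball x (inverse (Suc n)))"
    using seq_compact_imp_totally_bounded[OF assms[unfolded compact_eq_seq_compact_metric]]
    by (meson inverse_positive_iff_positive of_nat_0_less_iff zero_less_Suc)
  then obtain K where K: "\<And>n::nat. finite (K n)"
    "\<And>n::nat. Z \<subseteq> (\<Union>x\<in>K n. ball x (inverse (Suc n)))" by metis
  define B where "B n = (\<lambda>x. ball x (inverse (real (Suc n)))) ` K n" for n
  have "countable (insert {} (\<Union>n. B n))"
    using K(1) by (simp add: B_def countable_finite)
  then obtain U :: "nat \<Rightarrow> 'c set" where U: "range U = insert {} (\<Union>n. B n)"
    by (metis insert_not_empty uncountable_def)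
  show thesis
  proof (rule that)
    fix \<epsilon> :: real assume "0 < \<epsilon>"
    then obtain n where n: "inverse (real (Suc n)) < \<epsilon> / 2"
      using reals_Archimedean[of "\<epsilon> / 2"] by auto
    have "\<forall>b\<in>B n. \<exists>i. U i = b" using U by (metis UN_I UNIV_I image_iff insertI2)
    then obtain c where c: "\<And>b. b \<in> B n \<Longrightarrow> U (c b) = b" by metis
    have "finite (c ` B n)" using K(1) by (auto simp: B_def)
    then obtain N where N: "\<And>b. b \<in> B n \<Longrightarrow> c b < N"
      by (metis finite_nat_set_iff_bounded imageI)
    have "\<exists>i<N. z \<in> U i \<and> (\<forall>w\<in>U i. dist z w < \<epsilon>)" if z: "z \<in> Z" for z
    proof -
      obtain x where x: "x \<in> K n" "z \<in> ball x (inverse (Suc n))" using K(2) z by blast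
      then have b: "ball x (inverse (Suc n)) \<in> B n" by (auto simp: B_def)
      have "dist z w < \<epsilon>" if "w \<in> ball x (inverse (Suc n))" for w
        using x(2) that n dist_triangle3[of z w x] by (auto simp: dist_commute)
      then show ?thesis using N[OF b] c[OF b] x(2) by metis
    qed
    then show "\<exists>n. \<forall>z\<in>Z. \<exists>i<n. z \<in> U i \<and> (\<forall>w\<in>U i. dist z w < \<epsilon>)" by blast
  qed
qed

text \<open>At the first place where the digits differ the two sums differ by \<open>(1/3)^i\<close>, and the later
  digits can compensate at most half of that.  In base 2 they could compensate all of it, so the
  digits would not depend continuously on the sum.\<close>

lemma ternary_sums_separate:
  fixes b c :: "nat \<Rightarrow> bool"
  assumes i: "b i \<noteq> c i" and less: "\<And>j. j < i \<Longrightarrow> b j = c j"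
  shows "(1/3)^i / 2 \<le> \<bar>(\<Sum>n. of_bool (b n) * (1/3)^n) - (\<Sum>n. of_bool (c n) * (1/3::real)^n)\<bar>"
proof -
  define d where "d n = (of_bool (b n) - of_bool (c n)) * (1/3::real)^n" for n
  have sg: "summable (\<lambda>n. (1/3::real)^n)" by (simp add: summable_geometric)
  have s: "summable (\<lambda>n. of_bool (p n) * (1/3::real)^n)" for p
    by (rule summable_comparison_test'[OF sg]) auto
  have sd: "summable d" unfolding d_def using summable_diff[OF s[of b] s[of c]]
    by (simp add: algebra_simps)
  have db: "norm (d (n + Suc i)) \<le> (1/3)^(n + Suc i)" for n
    by (auto simp: d_def abs_mult)
  have sg': "summable (\<lambda>n. (1/3::real)^(n + Suc i))"
    using sg by (rule summable_ignore_initial_segment)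
  have "(\<Sum>n. (1/3::real)^(n + Suc i)) = (1/3)^i / 2"
    using suminf_mult2[OF sg, of "(1/3)^Suc i"] suminf_geometric[of "1/3::real"]
    by (simp add: power_add)
  then have tail: "\<bar>\<Sum>n. d (n + Suc i)\<bar> \<le> (1/3)^i / 2"
    using norm_suminf_le[OF db sg'] by simp
  have "(\<Sum>j<i. d j) = 0" using less by (simp add: d_def)
  then have head: "\<bar>\<Sum>j<Suc i. d j\<bar> = (1/3)^i"
    using i by (auto simp: d_def abs_mult)
  have "(\<Sum>n. of_bool (b n) * (1/3)^n) - (\<Sum>n. of_bool (c n) * (1/3::real)^n) = suminf d"
    unfolding d_def by (subst suminf_diff[OF s s]) (simp add: algebra_simps)
  also have "\<dots> = (\<Sum>n. d (n + Suc i)) + (\<Sum>j<Suc i. d j)"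
    using sd by (rule suminf_split_initial_segment)
  finally show ?thesis using tail head by linarith
qed

text \<open>The code of a point lists, as ternary digits, its membership in the sets of a separating
  sequence.  The code is in general not continuous, but its inverse is uniformly continuous.\<close>

lemma compact_coding_into_reals:
  fixes Z :: "'c::metric_space set"
  assumes "compact Z"
  obtains t :: "'c \<Rightarrow> real" where "t ` Z \<subseteq> {0..2}"
    "\<And>\<epsilon>. 0 < \<epsilon> \<Longrightarrow> \<exists>\<delta>>0. \<forall>z\<in>Z. \<forall>w\<in>Z. \<bar>t z - t w\<bar> < \<delta> \<longrightarrow> dist z w < \<epsilon>"
proof -
  obtain U :: "nat \<Rightarrow> 'c set"
    where U: "\<And>\<epsilon>. 0 < \<epsilon> \<Longrightarrow> \<exists>n. \<forall>z\<in>Z. \<exists>i<n. z \<in> U i \<and> (\<forall>w\<in>U i. dist z w < \<epsilon>)"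
    using separating_sequence_of_sets[OF assms] by blast
  define t where "t z = (\<Sum>n. of_bool (z \<in> U n) * (1/3::real)^n)" for z
  have sg: "summable (\<lambda>n. (1/3::real)^n)" by (simp add: summable_geometric)
  have s: "summable (\<lambda>n. of_bool (p n) * (1/3::real)^n)" for p
    by (rule summable_comparison_test'[OF sg]) auto
  have "0 \<le> t z" for z unfolding t_def by (intro suminf_nonneg s) auto
  moreover have "t z \<le> (\<Sum>n. (1/3::real)^n)" for z
    unfolding t_def by (intro suminf_le s sg) auto
  moreover have "(\<Sum>n. (1/3::real)^n) \<le> 2" using suminf_geometric[of "1/3::real"] by simp
  ultimately have "t ` Z \<subseteq> {0..2}" using order_trans by fastforce
  moreover have "\<exists>\<delta>>0. \<forall>z\<in>Z. \<forall>w\<in>Z. \<bar>t z - t w\<bar> < \<delta> \<longrightarrow> dist z w < \<epsilon>" if \<epsilon>: "0 < \<epsilon>" for \<epsilon>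
  proof -
    obtain n where n: "\<And>z. z \<in> Z \<Longrightarrow> \<exists>i<n. z \<in> U i \<and> (\<forall>w\<in>U i. dist z w < \<epsilon>)"
      using U[OF \<epsilon>] by blast
    have "dist z w < \<epsilon>" if zw: "z \<in> Z" "w \<in> Z" "\<bar>t z - t w\<bar> < (1/3)^n / 2" for z w
    proof (rule ccontr)
      assume far: "\<not> dist z w < \<epsilon>"
      obtain i where i: "i < n" "z \<in> U i" "\<forall>w\<in>U i. dist z w < \<epsilon>" using n zw(1) by blast
      define P where "P j \<longleftrightarrow> (z \<in> U j) \<noteq> (w \<in> U j)" for j
      have "P i" using i far by (auto simp: P_def)
      define k where "k = (LEAST j. P j)"
      have k: "P k" "k \<le> i" "\<And>j. j < k \<Longrightarrow> \<not> P j"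
        unfolding k_def using \<open>P i\<close> by (auto intro: LeastI Least_le dest: not_less_Least)
      have "(1/3)^k / 2 \<le> \<bar>t z - t w\<bar>" unfolding t_def
        by (rule ternary_sums_separate) (use k(1,3) in \<open>auto simp: P_def\<close>)
      moreover have "(1/3::real)^n \<le> (1/3)^k" using k(2) i(1) by (intro power_decreasing) auto
      ultimately show False using zw(3) by linarith
    qed
    then show ?thesis by (intro exI[of _ "(1/3)^n / 2"]) auto
  qed
  ultimately show thesis by (rule that)
qed


text \<open>\<open>C\<close> is the closure of the set of codes and \<open>g\<close> extends the decoding.  The (in general
  discontinuous) right inverse \<open>t\<close> of \<open>g\<close> is recorded because it lifts measures from \<open>Z\<close> to \<open>C\<close>.\<close>

lemma compact_continuous_image_of_real_compact:
  fixes Z :: "'c::metric_space set"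
  assumes Z: "compact Z"
  obtains C :: "real set" and t g
  where "compact C" "t ` Z \<subseteq> C" "continuous_on C g" "g ` C \<subseteq> Z" "\<And>z. z \<in> Z \<Longrightarrow> g (t z) = z"
proof -
  obtain t :: "'c \<Rightarrow> real" where t: "t ` Z \<subseteq> {0..2}"
    and sep: "\<And>\<epsilon>. 0 < \<epsilon> \<Longrightarrow> \<exists>\<delta>>0. \<forall>z\<in>Z. \<forall>w\<in>Z. \<bar>t z - t w\<bar> < \<delta> \<longrightarrow> dist z w < \<epsilon>"
    using compact_coding_into_reals[OF Z] by blast
  have inj: "z = w" if "z \<in> Z" "w \<in> Z" "t z = t w" for z w
  proof (rule ccontr)
    assume "z \<noteq> w"
    then have "\<exists>\<delta>>0. \<forall>z'\<in>Z. \<forall>w'\<in>Z. \<bar>t z' - t w'\<bar> < \<delta> \<longrightarrow> dist z' w' < dist z w"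
      by (intro sep) simp
    then show False using that by fastforce
  qed
  then have inv: "inv_into Z t (t z) = z" if "z \<in> Z" for z
    using that by (auto intro!: inv_into_f_f inj_onI)
  \<comment> \<open>Uniformly continuous maps extend to closures only into complete spaces, hence the detour through
    the space of sequences.\<close>
  obtain e :: "'c \<Rightarrow> nat \<Rightarrow> real" and e' where e: "homeomorphism Z (e ` Z) e e'"
    using compact_embeds_sequences[OF Z] by blast
  have "uniformly_continuous_on Z e"
    using e Z by (auto simp: homeomorphism_def intro: compact_uniformly_continuous)
  have "uniformly_continuous_on (t ` Z) (\<lambda>s. e (inv_into Z t s))"
    unfolding uniformly_continuous_on_def
  proof (intro allI impI)
    fix \<epsilon> :: real assume "0 < \<epsilon>"
    then obtain \<eta> where \<eta>: "0 < \<eta>" "\<And>z w. z \<in> Z \<Longrightarrow> w \<in> Z \<Longrightarrow> dist z w < \<eta> \<Longrightarrow> dist (e z) (e w) < \<epsilon>"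
      using \<open>uniformly_continuous_on Z e\<close> unfolding uniformly_continuous_on_def by metis
    obtain \<delta> where "0 < \<delta>" "\<forall>z\<in>Z. \<forall>w\<in>Z. \<bar>t z - t w\<bar> < \<delta> \<longrightarrow> dist z w < \<eta>"
      using sep[OF \<eta>(1)] by blast
    then show "\<exists>\<delta>>0. \<forall>x\<in>t ` Z. \<forall>x'\<in>t ` Z. dist x' x < \<delta> \<longrightarrow>
        dist (e (inv_into Z t x')) (e (inv_into Z t x)) < \<epsilon>"
      using \<eta>(2) by (intro exI[of _ \<delta>]) (auto simp: inv dist_real_def)
  qed
  then obtain G where G: "uniformly_continuous_on (closure (t ` Z)) G"
    "\<And>s. s \<in> t ` Z \<Longrightarrow> e (inv_into Z t s) = G s"
    using uniformly_continuous_on_extension_on_closure by metis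
  have cG: "continuous_on (closure (t ` Z)) G"
    using G(1) by (rule uniformly_continuous_imp_continuous)
  have "closed (e ` Z)"
    using e Z by (auto simp: homeomorphism_def intro: compact_imp_closed compact_continuous_image)
  then have im: "G ` closure (t ` Z) \<subseteq> e ` Z"
    using G(2) by (intro image_closure_subset[OF cG]) (auto simp: inv simp flip: G(2))
  have "bounded (t ` Z)" using t by (rule bounded_subset[OF bounded_closed_interval])
  show thesis
  proof (rule that)
    show "compact (closure (t ` Z))" using \<open>bounded (t ` Z)\<close> by (simp add: compact_closure)
    show "t ` Z \<subseteq> closure (t ` Z)" by (rule closure_subset)
    show "continuous_on (closure (t ` Z)) (e' \<circ> G)"
      unfolding comp_def
      by (rule continuous_on_compose2[OF homeomorphism_cont2[OF e] cG im])
    show "(e' \<circ> G) ` closure (t ` Z) \<subseteq> Z"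
      using e im by (auto simp: homeomorphism_def)
    show "(e' \<circ> G) (t z) = z" if "z \<in> Z" for z
      using that e by (auto simp: homeomorphism_def inv simp flip: G(2))
  qed
qed

section \<open>Weak limits of discrete measures on compact metric spaces\<close>

text \<open>Discrete measures suffice for empirical measures, and they can be pushed forward along the
  right inverse \<open>t\<close> even though \<open>t\<close> need not be measurable for the Borel sets.\<close>

lemma compact_pmf_weak_limit:
  fixes p :: "nat \<Rightarrow> 'c::metric_space pmf"
  assumes Z: "compact Z" and p: "\<And>n. set_pmf (p n) \<subseteq> Z"
  obtains r M where "strict_mono (r :: nat \<Rightarrow> nat)" "prob_space M"
    "sets M = sets (restrict_space borel Z)"
    "\<And>f :: 'c \<Rightarrow> real. continuous_on Z f \<Longrightarrow>
       (\<lambda>n. measure_pmf.expectation (p (r n)) f) \<longlonglongrightarrow> (LINT z|M. f z)"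
proof -
  obtain C :: "real set" and t g where C: "compact C" "t ` Z \<subseteq> C"
    and g: "continuous_on C g" "g ` C \<subseteq> Z" "\<And>z. z \<in> Z \<Longrightarrow> g (t z) = z"
    using compact_continuous_image_of_real_compact[OF Z] by metis
  obtain z0 where z0: "z0 \<in> Z" using p[of 0] set_pmf_not_empty[of "p 0"] by blast
  have "closed C" using C(1) by (rule compact_imp_closed)
  define \<mu> where "\<mu> n = distr (measure_pmf (p n)) borel t" for n
  have \<mu>: "real_distribution (\<mu> n)" for n
    unfolding \<mu>_def by (auto simp: real_distribution_def real_distribution_axioms_def
        intro!: measure_pmf.prob_space_distr)
  obtain b where b: "0 < b" "\<And>x. x \<in> C \<Longrightarrow> \<bar>x\<bar> \<le> b"
    using compact_imp_bounded[OF C(1)] unfolding bounded_pos by auto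
  have "measure (\<mu> n) {-b - 1<..b} = 1" for n
  proof -
    have "t z \<in> {-b - 1<..b}" if "z \<in> set_pmf (p n)" for z
      using b(2)[of "t z"] C(2) p[of n] that by force
    then have "measure_pmf.prob (p n) (t -` {-b - 1<..b}) = 1"
      by (auto simp: measure_pmf.prob_eq_1 AE_measure_pmf_iff)
    then show ?thesis by (simp add: \<mu>_def measure_distr)
  qed
  then have "\<exists>a b. a < b \<and> (\<forall>n. 1 - \<epsilon> < measure (\<mu> n) {a<..b})" if "0 < \<epsilon>" for \<epsilon> :: real
    using that b(1) by (intro exI[of _ "-b - 1"] exI[of _ b]) simp
  then have "tight \<mu>" unfolding tight_def using \<mu> by blast
  then obtain r M' where r: "strict_mono (r :: nat \<Rightarrow> nat)" "real_distribution M'"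
    "weak_conv_m (\<mu> \<circ> id \<circ> r) M'"
    using tight_imp_convergent_subsubsequence[of \<mu> id] by (auto simp: strict_mono_def)
  interpret M': real_distribution M' by fact
  have conv: "(\<lambda>n. measure_pmf.expectation (p (r n)) (\<lambda>z. F (t z))) \<longlonglongrightarrow> (LINT x|M'. F x)"
    if F: "continuous_on UNIV F" "\<And>x. \<bar>F x\<bar> \<le> B" for F :: "real \<Rightarrow> real" and B
  proof -
    have "(\<lambda>n. LINT x|(\<mu> \<circ> id \<circ> r) n. F x) \<longlonglongrightarrow> (LINT x|M'. F x)"
      using F by (intro weak_conv_imp_integral_bdd_continuous_conv[where B=B] r(2,3))
        (auto simp: \<mu> continuous_on_eq_continuous_at)
    moreover have "F \<in> borel_measurable borel" using F(1) by (rule borel_measurable_continuous_onI)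
    ultimately show ?thesis by (simp add: \<mu>_def integral_distr)
  qed
  \<comment> \<open>The limit does not charge the complement of \<open>C\<close>: the distance to \<open>C\<close>, truncated so as to be
    bounded, integrates to 0.\<close>
  have inC: "AE x in M'. x \<in> C"
  proof -
    let ?F = "\<lambda>x. min 1 (infdist x C)"
    have cF: "continuous_on UNIV ?F" by (intro continuous_intros)
    have bF: "\<bar>?F x\<bar> \<le> 1" "0 \<le> ?F x" for x using infdist_nonneg[of x C] by auto
    have "measure_pmf.expectation (p (r n)) (\<lambda>z. ?F (t z)) = measure_pmf.expectation (p (r n)) (\<lambda>_. 0)" for n
    proof (rule integral_cong_AE)
      have "infdist (t z) C = 0" if "z \<in> set_pmf (p (r n))" for z
        using that C(2) p[of "r n"] by (intro infdist_zero) auto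
      then show "AE z in measure_pmf (p (r n)). ?F (t z) = 0" by (simp add: AE_measure_pmf_iff)
    qed simp_all
    then have "(\<lambda>_. 0) \<longlonglongrightarrow> (LINT x|M'. ?F x)" using conv[OF cF bF(1)] by simp
    then have zero: "(LINT x|M'. ?F x) = 0" by (simp add: LIMSEQ_const_iff)
    have "integrable M' ?F"
    proof (rule M'.integrable_const_bound)
      show "AE x in M'. norm (?F x) \<le> 1" using bF(1) by (simp only: real_norm_def) simp
      show "?F \<in> borel_measurable M'"
        unfolding measurable_cong_sets[OF M'.events_eq_borel refl] by (rule borel_measurable_continuous_onI[OF cF])
    qed
    then have "AE x in M'. ?F x = 0"
      using zero integral_nonneg_eq_0_iff_AE[of M' ?F] bF(2) by simp
    then show ?thesis
    proof eventually_elim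
      case (elim x)
      then have "infdist x C = 0" by (auto simp: min_def split: if_splits)
      moreover have "C \<noteq> {}" using C(2) z0 by auto
      ultimately show ?case using in_closed_iff_infdist_zero[OF \<open>closed C\<close>] by blast
    qed
  qed
  \<comment> \<open>The value \<open>z0\<close> is taken on a null set only.\<close>
  define h where "h x = (if x \<in> C then g x else z0)" for x
  have "g \<in> restrict_space borel C \<rightarrow>\<^sub>M borel"
    using g(1) by (rule borel_measurable_continuous_on_restrict)
  then have "g \<in> restrict_space borel C \<rightarrow>\<^sub>M restrict_space borel Z"
    using g(2) by (intro measurable_restrict_space2) (auto simp: space_restrict_space)
  then have h: "h \<in> M' \<rightarrow>\<^sub>M restrict_space borel Z"
    unfolding h_def using z0 \<open>closed C\<close>
    by (subst (asm) measurable_restrict_space_iff[where c=z0])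
      (auto simp: space_restrict_space measurable_cong_sets[OF M'.events_eq_borel refl])
  show thesis
  proof (rule that)
    show "strict_mono r" by (rule r(1))
    show "prob_space (distr M' (restrict_space borel Z) h)" by (rule M'.prob_space_distr[OF h])
    show "sets (distr M' (restrict_space borel Z) h) = sets (restrict_space borel Z)" by simp
    fix f :: "'c \<Rightarrow> real" assume f: "continuous_on Z f"
    then have fm: "f \<in> borel_measurable (restrict_space borel Z)"
      by (rule borel_measurable_continuous_on_restrict)
    obtain B where B: "0 < B" "\<And>z. z \<in> Z \<Longrightarrow> \<bar>f z\<bar> \<le> B"
      using compact_imp_bounded[OF compact_continuous_image[OF f Z]] unfolding bounded_pos by auto
    have "continuous_on C (\<lambda>x. f (g x))" by (rule continuous_on_compose2[OF f g(1,2)])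
    moreover have "norm (f (g x)) \<le> B" if "x \<in> C" for x using B(2) g(2) that by auto
    ultimately obtain F where F: "continuous_on UNIV F" "\<And>x. x \<in> C \<Longrightarrow> F x = f (g x)"
      "\<And>x. \<bar>F x\<bar> \<le> B"
      using Tietze[of C "\<lambda>x. f (g x)" UNIV B] B(1) \<open>closed C\<close> by auto
    have "measure_pmf.expectation (p (r n)) (\<lambda>z. F (t z)) = measure_pmf.expectation (p (r n)) f" for n
    proof (rule integral_cong_AE)
      have "F (t z) = f z" if "z \<in> set_pmf (p (r n))" for z
      proof -
        have "z \<in> Z" using that p by blast
        then show ?thesis using C(2) F(2)[of "t z"] g(3) by auto
      qed
      then show "AE z in measure_pmf (p (r n)). F (t z) = f z" by (simp add: AE_measure_pmf_iff)
    qed simp_all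
    moreover have "(LINT x|M'. F x) = (LINT z|distr M' (restrict_space borel Z) h. f z)"
    proof -
      have "(LINT z|distr M' (restrict_space borel Z) h. f z) = (LINT x|M'. f (h x))"
        by (rule integral_distr[OF h fm])
      also have "\<dots> = (LINT x|M'. F x)"
      proof (rule integral_cong_AE)
        show "(\<lambda>x. f (h x)) \<in> borel_measurable M'" using measurable_compose[OF h fm] .
        show "F \<in> borel_measurable M'" using borel_measurable_continuous_onI[OF F(1)] by simp
        show "AE x in M'. f (h x) = F x" using inC by eventually_elim (simp add: h_def F(2))
      qed
      finally show ?thesis by simp
    qed
    ultimately show "(\<lambda>n. measure_pmf.expectation (p (r n)) f)
        \<longlonglongrightarrow> (LINT z|distr M' (restrict_space borel Z) h. f z)"
      using conv[OF F(1,3)] by simp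
  qed
qed

text \<open>The functions \<open>x \<mapsto> max 0 (1 - n * infdist x A)\<close> decrease to the indicator of a nonempty closed
  set \<open>A\<close>,
  and the closed sets are a generator of the Borel sets stable under intersection.\<close>

lemma prob_measure_eq_if_continuous_integrals_eq:
  fixes X :: "'a::metric_space set"
  assumes M: "prob_space M" "sets M = sets (restrict_space borel X)"
    and N: "prob_space N" "sets N = sets (restrict_space borel X)"
    and eq: "\<And>f :: 'a \<Rightarrow> real. continuous_on X f \<Longrightarrow> (\<And>x. \<bar>f x\<bar> \<le> 1) \<Longrightarrow> (LINT x|M. f x) = (LINT x|N. f x)"
  shows "M = N"
proof -
  have sp: "space M = X" "space N = X"
    using sets_eq_imp_space_eq[OF M(2)] sets_eq_imp_space_eq[OF N(2)] by (simp_all add: space_restrict_space)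
  have lim: "(\<lambda>n. LINT x|K. max 0 (1 - real n * infdist x A)) \<longlonglongrightarrow> measure K (A \<inter> X)"
    if K: "prob_space K" "sets K = sets (restrict_space borel X)" and A: "closed A" "A \<noteq> {}" for A K
  proof -
    interpret K: prob_space K by fact
    have spK: "space K = X" using sets_eq_imp_space_eq[OF K(2)] by (simp add: space_restrict_space)
    have AX: "A \<inter> X \<in> sets K" using A(1) by (auto simp: K(2) sets_restrict_space)
    have "(\<lambda>n. LINT x|K. max 0 (1 - real n * infdist x A)) \<longlonglongrightarrow> (LINT x|K. indicator (A \<inter> X) x)"
    proof (rule integral_dominated_convergence[where w="\<lambda>_. 1"])
      show "(\<lambda>x. indicator (A \<inter> X) x :: real) \<in> borel_measurable K" using AX by simp
      show "(\<lambda>x. max 0 (1 - real n * infdist x A)) \<in> borel_measurable K" for n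
        unfolding measurable_cong_sets[OF K(2) refl]
        by (intro borel_measurable_continuous_on_restrict continuous_intros)
      show "AE x in K. norm (max 0 (1 - real n * infdist x A)) \<le> 1" for n
        by (simp add: infdist_nonneg)
      have "(\<lambda>n. max 0 (1 - real n * infdist x A)) \<longlonglongrightarrow> indicator (A \<inter> X) x" if "x \<in> X" for x
      proof (cases "x \<in> A")
        case True then show ?thesis using that by simp
      next
        case False
        then have pos: "0 < infdist x A"
          using in_closed_iff_infdist_zero[OF A] infdist_nonneg[of x A] by fastforce
        obtain n0 :: nat where n0: "1 < n0 * infdist x A" using reals_Archimedean3[OF pos] by blast
        have "\<forall>\<^sub>F n in sequentially. max 0 (1 - real n * infdist x A) = indicator (A \<inter> X) x"
          using eventually_ge_at_top[of n0]
        proof eventually_elim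
          case (elim n)
          then have "n0 * infdist x A \<le> n * infdist x A" using pos by (simp add: mult_right_mono)
          then show ?case using n0 False by simp
        qed
        then show ?thesis by (rule tendsto_eventually)
      qed
      then show "AE x in K. (\<lambda>n. max 0 (1 - real n * infdist x A)) \<longlonglongrightarrow> indicator (A \<inter> X) x"
        by (auto simp: spK)
    qed simp
    then show ?thesis using spK AX by (simp add: Int_absorb2)
  qed
  interpret M: prob_space M by fact
  interpret N: prob_space N by fact
  have idM: "(\<lambda>x. x) \<in> M \<rightarrow>\<^sub>M borel" and idN: "(\<lambda>x. x) \<in> N \<rightarrow>\<^sub>M borel"
    unfolding measurable_cong_sets[OF M(2) refl] measurable_cong_sets[OF N(2) refl]
    by (auto intro: measurable_restrict_space1)
  have "distr M borel (\<lambda>x. x) = distr N borel (\<lambda>x. x)"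
  proof (rule measure_eqI_generator_eq[where E="Collect closed" and \<Omega>=UNIV and A="\<lambda>_. UNIV"])
    show "emeasure (distr M borel (\<lambda>x. x)) A = emeasure (distr N borel (\<lambda>x. x)) A"
      if "A \<in> Collect closed" for A
    proof (cases "A = {}")
      case False
      have "measure M (A \<inter> X) = measure N (A \<inter> X)"
      proof (rule LIMSEQ_unique)
        show "(\<lambda>n. LINT x|M. max 0 (1 - real n * infdist x A)) \<longlonglongrightarrow> measure M (A \<inter> X)"
          using lim[OF M] that False by simp
        have "(LINT x|M. max 0 (1 - real n * infdist x A)) = (LINT x|N. max 0 (1 - real n * infdist x A))" for n
          by (intro eq continuous_intros) (simp add: infdist_nonneg)
        then show "(\<lambda>n. LINT x|M. max 0 (1 - real n * infdist x A)) \<longlonglongrightarrow> measure N (A \<inter> X)"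
          using lim[OF N] that False by simp
      qed
      then show ?thesis using that idM idN
        by (simp add: emeasure_distr sp M.emeasure_eq_measure N.emeasure_eq_measure)
    qed simp
  qed (use M.emeasure_space_1 idM in \<open>auto simp: Int_stable_def borel_eq_closed emeasure_distr sp\<close>)
  then have *: "emeasure M (A \<inter> X) = emeasure N (A \<inter> X)" if "A \<in> sets borel" for A
    using that idM idN by (metis emeasure_distr sp vimage_ident)
  show ?thesis
  proof (rule measure_eqI)
    show "sets M = sets N" using M(2) N(2) by simp
    show "emeasure M A = emeasure N A" if "A \<in> sets M" for A
      using that * unfolding M(2) sets_restrict_space by (auto simp: Int_commute)
  qed
qed

section \<open>Invariant measures from averages along orbits\<close>

lemma compact_sequence_space:
  fixes X :: "'a::metric_space set"
  assumes "compact X"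
  shows "compact {z :: nat \<Rightarrow> 'a. \<forall>j. z j \<in> X}"
proof -
  have "{z :: nat \<Rightarrow> 'a. \<forall>j. z j \<in> X} = (\<Pi>\<^sub>E j\<in>UNIV. X)" by auto
  moreover have "compactin (product_topology (\<lambda>_. euclidean) UNIV) (\<Pi>\<^sub>E j\<in>(UNIV :: nat set). X)"
    using assms by (simp add: compactin_PiE)
  ultimately show ?thesis by (simp add: euclidean_product_topology)
qed

lemma telescoping_average_tendsto_0:
  fixes a :: "nat \<Rightarrow> nat \<Rightarrow> real"
  assumes "\<And>n i. \<bar>a n i\<bar> \<le> 1" and "\<And>n. n < N n"
  shows "(\<lambda>n. (\<Sum>i<N n. a n (Suc i)) / real (N n) - (\<Sum>i<N n. a n i) / real (N n)) \<longlonglongrightarrow> 0"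
proof (rule Lim_null_comparison)
  show "\<forall>\<^sub>F n in sequentially. norm ((\<Sum>i<N n. a n (Suc i)) / real (N n) - (\<Sum>i<N n. a n i) / real (N n))
      \<le> 2 / real (Suc n)"
  proof (intro always_eventually allI)
    fix n
    have "(\<Sum>i<N n. a n (Suc i)) / real (N n) - (\<Sum>i<N n. a n i) / real (N n) = (a n (N n) - a n 0) / real (N n)"
      by (simp add: sum_lessThan_telescope flip: diff_divide_distrib sum_subtractf)
    also have "norm \<dots> \<le> 2 / real (Suc n)"
      using assms(1)[of n "N n"] assms(1)[of n 0] assms(2)[of n]
      by (auto intro!: frac_le simp: abs_divide)
    finally show "norm ((\<Sum>i<N n. a n (Suc i)) / real (N n) - (\<Sum>i<N n. a n i) / real (N n)) \<le> 2 / real (Suc n)" .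
  qed
  show "(\<lambda>n. 2 / real (Suc n)) \<longlonglongrightarrow> 0"
    using LIMSEQ_Suc[OF lim_const_over_n[of 2]] by simp
qed

text \<open>The Krylov-Bogolyubov construction for tuples, with the starting tuple varying along with the
  averaging time.  Tuples are completed to sequences, since functions on \<open>nat\<close> form a metric space.
  A marginal is invariant because the averages of \<open>f\<close> and \<open>f \<circ> \<phi>\<close> differ only by boundary
  terms.\<close>

lemma orbit_averages_weak_limit:
  fixes X :: "'a::metric_space set" and x :: "nat \<Rightarrow> nat \<Rightarrow> 'a"
  assumes tds: "tds X \<phi>" and x: "\<And>n j. x n j \<in> X" and N: "\<And>n. n < N n"
  obtains r M where "strict_mono (r :: nat \<Rightarrow> nat)" "prob_space M"
    "sets M = sets (restrict_space borel {z. \<forall>j. z j \<in> X})"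
    "\<And>f :: (nat \<Rightarrow> 'a) \<Rightarrow> real. continuous_on {z. \<forall>j. z j \<in> X} f \<Longrightarrow>
       (\<lambda>n. (\<Sum>i<N (r n). f (\<lambda>j. (\<phi> ^^ i) (x (r n) j))) / real (N (r n))) \<longlonglongrightarrow> (LINT z|M. f z)"
    "\<And>j. invariant_measure X \<phi> (distr M (restrict_space borel X) (\<lambda>z. z j))"
proof -
  define Z :: "(nat \<Rightarrow> 'a) set" where "Z = {z. \<forall>j. z j \<in> X}"
  have X: "compact X" and c\<phi>: "continuous_on X \<phi>" and \<phi>X: "\<And>x. x \<in> X \<Longrightarrow> \<phi> x \<in> X"
    using tds by (auto simp: tds_def homeomorphism_def)
  have orbX: "(\<phi> ^^ i) u \<in> X" if "u \<in> X" for i u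
    using that by (induction i) (auto simp: \<phi>X)
  have Z: "compact Z" unfolding Z_def by (rule compact_sequence_space[OF X])
  define p where "p n = map_pmf (\<lambda>i j. (\<phi> ^^ i) (x n j)) (pmf_of_set {..<N n})" for n
  have ne: "{..<N n} \<noteq> {}" for n using N[of n] by auto
  have "set_pmf (p n) \<subseteq> Z" for n by (auto simp: p_def set_pmf_of_set[OF ne] Z_def orbX x)
  then obtain r M where r: "strict_mono (r :: nat \<Rightarrow> nat)" "prob_space M"
    "sets M = sets (restrict_space borel Z)"
    and conv: "\<And>f :: (nat \<Rightarrow> 'a) \<Rightarrow> real. continuous_on Z f \<Longrightarrow>
       (\<lambda>n. measure_pmf.expectation (p (r n)) f) \<longlonglongrightarrow> (LINT z|M. f z)"
    using compact_pmf_weak_limit[OF Z] by metis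
  have avg: "measure_pmf.expectation (p n) f = (\<Sum>i<N n. f (\<lambda>j. (\<phi> ^^ i) (x n j))) / real (N n)"
    for n and f :: "(nat \<Rightarrow> 'a) \<Rightarrow> real"
    using integral_pmf_of_set[OF ne] by (simp add: p_def)
  interpret M: prob_space M by (rule r(2))
  have inv: "invariant_measure X \<phi> (distr M (restrict_space borel X) (\<lambda>z. z j))" for j
  proof -
    let ?\<mu> = "distr M (restrict_space borel X) (\<lambda>z. z j)"
    have cj: "continuous_on S (\<lambda>z :: nat \<Rightarrow> 'a. z j)" for S
      by (rule continuous_on_subset[OF continuous_on_product_coordinates]) simp
    have mj: "(\<lambda>z. z j) \<in> M \<rightarrow>\<^sub>M restrict_space borel X"
      unfolding measurable_cong_sets[OF r(3) refl]
      by (intro measurable_restrict_space2 borel_measurable_continuous_on_restrict cj)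
        (auto simp: space_restrict_space Z_def)
    have m\<phi>: "\<phi> \<in> restrict_space borel X \<rightarrow>\<^sub>M restrict_space borel X"
      by (intro measurable_restrict_space2 borel_measurable_continuous_on_restrict c\<phi>)
        (auto simp: space_restrict_space \<phi>X)
    have m\<phi>': "\<phi> \<in> ?\<mu> \<rightarrow>\<^sub>M ?\<mu>" using m\<phi> by simp
    have ps: "prob_space ?\<mu>" by (rule M.prob_space_distr[OF mj])
    have "distr ?\<mu> ?\<mu> \<phi> = ?\<mu>"
    proof (rule prob_measure_eq_if_continuous_integrals_eq[of _ X])
      show "prob_space (distr ?\<mu> ?\<mu> \<phi>)" by (rule prob_space.prob_space_distr[OF ps m\<phi>'])
      fix f :: "'a \<Rightarrow> real" assume f: "continuous_on X f" "\<And>x. \<bar>f x\<bar> \<le> 1"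
      then have fm: "f \<in> borel_measurable (restrict_space borel X)"
        by (intro borel_measurable_continuous_on_restrict)
      have c1: "continuous_on Z (\<lambda>z. f (z j))"
        using f(1) cj by (rule continuous_on_compose2) (auto simp: Z_def)
      have "continuous_on Z (\<lambda>z. \<phi> (z j))"
        using c\<phi> cj by (rule continuous_on_compose2) (auto simp: Z_def)
      with f(1) have c2: "continuous_on Z (\<lambda>z. f (\<phi> (z j)))"
        by (rule continuous_on_compose2) (auto simp: Z_def \<phi>X)
      have lt: "n < N (r n)" for n using seq_suble[OF r(1), of n] N[of "r n"] by simp
      have "(LINT z|M. f (\<phi> (z j))) - (LINT z|M. f (z j)) = 0"
      proof (rule LIMSEQ_unique[OF tendsto_diff[OF conv[OF c2] conv[OF c1]]])
        show "(\<lambda>n. measure_pmf.expectation (p (r n)) (\<lambda>z. f (\<phi> (z j)))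
            - measure_pmf.expectation (p (r n)) (\<lambda>z. f (z j))) \<longlonglongrightarrow> 0"
          using telescoping_average_tendsto_0[of "\<lambda>n i. f ((\<phi> ^^ i) (x (r n) j))" "\<lambda>n. N (r n)", OF f(2) lt]
          by (simp add: avg)
      qed
      then show "(LINT u|distr ?\<mu> ?\<mu> \<phi>. f u) = (LINT u|?\<mu>. f u)"
        using mj fm measurable_compose[OF m\<phi> fm]
        by (simp add: integral_distr[OF m\<phi>'] integral_distr[OF mj])
    qed (use ps in auto)
    then show ?thesis using ps by (simp add: invariant_measure_def)
  qed
  show thesis
  proof (rule that[OF r(1,2) r(3)[unfolded Z_def] _ inv])
    fix f :: "(nat \<Rightarrow> 'a) \<Rightarrow> real" assume "continuous_on {z. \<forall>j. z j \<in> X} f"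
    then show "(\<lambda>n. (\<Sum>i<N (r n). f (\<lambda>j. (\<phi> ^^ i) (x (r n) j))) / real (N (r n))) \<longlonglongrightarrow> (LINT z|M. f z)"
      by (rule conv[of f, unfolded avg Z_def])
  qed
qed

section \<open>The minimal and maximal distances in a tuple\<close>

lemma continuous_on_Min_image:
  fixes f :: "'i \<Rightarrow> 'a::topological_space \<Rightarrow> real"
  assumes "finite I" "I \<noteq> {}" "\<And>i. i \<in> I \<Longrightarrow> continuous_on S (f i)"
  shows "continuous_on S (\<lambda>x. Min ((\<lambda>i. f i x) ` I))"
  using assms
proof (induction I rule: finite_ne_induct)
  case (insert i I)
  then show ?case by (auto intro!: continuous_on_min)
qed simp


lemma D_min_image: "D_min k x = Min ((\<lambda>(i, j). dist (x i) (x j)) ` {(i, j). 1 \<le> i \<and> i < j \<and> j \<le> k})"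
  unfolding D_min_def by (rule arg_cong[of _ _ Min]) auto

lemma finite_index_pairs: "finite {(i, j). 1 \<le> i \<and> i < j \<and> j \<le> (k::nat)}"
  by (rule finite_subset[of _ "{..k} \<times> {..k}"]) auto

lemma D_min_cong: "(\<And>i. i \<in> {1..k} \<Longrightarrow> x i = y i) \<Longrightarrow> D_min k x = D_min k y"
  unfolding D_min_image by (intro arg_cong[of _ _ Min] image_cong) auto

lemma D_min_le_dist: "1 \<le> i \<Longrightarrow> i < j \<Longrightarrow> j \<le> k \<Longrightarrow> D_min k x \<le> dist (x i) (x j)"
  unfolding D_min_image using finite_index_pairs[of k] by (intro Min_le) force+

lemma dist_le_D_max:
  assumes "1 \<le> i" "i < j" "j \<le> k"
  shows "dist (x i) (x j) \<le> D_max k x"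
proof -
  have "{dist (x i) (x j) | i j. 1 \<le> i \<and> i < j \<and> j \<le> k}
      = (\<lambda>(i, j). dist (x i) (x j)) ` {(i, j). 1 \<le> i \<and> i < j \<and> j \<le> k}" by auto
  then show ?thesis
    unfolding D_max_def using finite_index_pairs[of k] assms by (intro Max_ge) force+
qed

lemma continuous_on_D_min:
  assumes "2 \<le> k"
  shows "continuous_on S (D_min k)"
proof -
  have "(1, 2) \<in> {(i, j). 1 \<le> i \<and> i < j \<and> j \<le> k}" using assms by auto
  then have "{(i, j). 1 \<le> i \<and> i < j \<and> j \<le> k} \<noteq> {}" by blast
  then have "continuous_on S (\<lambda>x. Min ((\<lambda>ij. case ij of (i, j) \<Rightarrow> dist (x i) (x j)) `
      {(i, j). 1 \<le> i \<and> i < j \<and> j \<le> k}))"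
    by (intro continuous_on_Min_image finite_index_pairs)
      (auto simp del: Collect_empty_eq intro!: continuous_on_dist continuous_on_subset[OF continuous_on_product_coordinates])
  then show ?thesis by (simp add: D_min_image[abs_def])
qed

lemma D_min_nonpos_if_few_values:
  assumes "\<And>i. i \<in> {1..m + 1} \<Longrightarrow> \<exists>l\<in>{1..m}. z i = c l"
  shows "D_min (m + 1) z \<le> 0"
proof -
  have "\<forall>i\<in>{1..m + 1}. \<exists>l. l \<in> {1..m} \<and> z i = c l" using assms by blast
  from bchoice[OF this] obtain l where l: "\<forall>i\<in>{1..m + 1}. l i \<in> {1..m} \<and> z i = c (l i)" ..
  have "\<not> inj_on l {1..m + 1}"
  proof
    assume "inj_on l {1..m + 1}"
    then have "card {1..m + 1} \<le> card {1..m}" using l by (intro card_inj_on_le) auto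
    then show False by simp
  qed
  then obtain i j where ij: "i \<in> {1..m + 1}" "j \<in> {1..m + 1}" "i \<noteq> j" "l i = l j"
    by (auto simp: inj_on_def)
  then have "z i = z j" using l by metis
  then show ?thesis
    using ij D_min_le_dist[of i j "m + 1" z] D_min_le_dist[of j i "m + 1" z]
    by (cases i j rule: linorder_cases) auto
qed

section \<open>Finite-to-one topomorphic extensions\<close>

lemma orbits_uniformly_close_in_equicontinuous_factor:
  assumes tds: "tds X \<phi>" and eq: "equicontinuous_tds Y \<psi>" and \<pi>: "factor_map X \<phi> Y \<psi> \<pi>"
    and \<epsilon>: "0 < \<epsilon>"
  shows "\<exists>\<delta>>0. \<forall>x\<in>X. \<forall>y\<in>X. dist x y < \<delta> \<longrightarrow>
    (\<forall>n. dist (\<pi> ((\<phi> ^^ n) x)) (\<pi> ((\<phi> ^^ n) y)) < \<epsilon>)"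
proof -
  have X: "compact X" "\<And>x. x \<in> X \<Longrightarrow> \<phi> x \<in> X" using tds by (auto simp: tds_def homeomorphism_def)
  have "(\<phi> ^^ n) x \<in> X \<and> \<pi> ((\<phi> ^^ n) x) = (\<psi> ^^ n) (\<pi> x)" if "x \<in> X" for x n
    using \<pi> that X(2) by (induction n) (auto simp: factor_map_def)
  moreover obtain \<eta> where "0 < \<eta>" "\<forall>x\<in>Y. \<forall>y\<in>Y. dist x y < \<eta> \<longrightarrow>
      (\<forall>n. dist ((\<psi> ^^ n) x) ((\<psi> ^^ n) y) < \<epsilon>)"
    using eq \<epsilon> unfolding equicontinuous_tds_def by metis
  moreover have "uniformly_continuous_on X \<pi>" "\<And>x. x \<in> X \<Longrightarrow> \<pi> x \<in> Y"
    using \<pi> X(1) by (auto simp: factor_map_def intro: compact_uniformly_continuous)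
  ultimately show ?thesis unfolding uniformly_continuous_on_def by (metis dist_commute)
qed

lemma frequently_large_average_if_D_mean_ge:
  assumes "\<not> D_mean k \<phi> x < ereal \<epsilon>" "0 < \<epsilon>"
  shows "\<exists>N>n. \<epsilon> / 2 < (\<Sum>i<N. D_min k (\<lambda>j. (\<phi> ^^ i) (x j))) / real N"
proof (rule ccontr)
  assume small: "\<not> (\<exists>N>n. \<epsilon> / 2 < (\<Sum>i<N. D_min k (\<lambda>j. (\<phi> ^^ i) (x j))) / real N)"
  have "ereal (1 / real N * (\<Sum>i<N. D_min k (\<lambda>j. (\<phi> ^^ i) (x j)))) \<le> ereal (\<epsilon> / 2)" if "n < N" for N
  proof -
    have "\<not> \<epsilon> / 2 < (\<Sum>i<N. D_min k (\<lambda>j. (\<phi> ^^ i) (x j))) / real N" using small that by blast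
    then show ?thesis by simp
  qed
  then have "\<forall>\<^sub>F N in sequentially. ereal (1 / real N * (\<Sum>i<N. D_min k (\<lambda>j. (\<phi> ^^ i) (x j)))) \<le> ereal (\<epsilon> / 2)"
    by (rule eventually_mono[OF eventually_gt_at_top[of n]])
  then have "D_mean k \<phi> x \<le> ereal (\<epsilon> / 2)" unfolding D_mean_def by (rule Limsup_bounded)
  also have "\<dots> < ereal \<epsilon>" using assms(2) by simp
  finally show False using assms(1) by simp
qed

text \<open>Of the two parts of the contradiction, the pigeonhole part rests on \<open>z i = \<gamma> (\<pi> (z i)) l\<close> for
  some \<open>l\<close>, whenever \<open>z i\<close> lies in the union of the images of the sections: if moreover all entries of
  \<open>z\<close> lie over the same point, they are among \<open>m\<close> points that do not depend on \<open>i\<close>.\<close>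

lemma topomorphic_section_imp_mean_equicontinuous:
  fixes X :: "'a::metric_space set" and Y :: "'b::metric_space set"
  assumes m: "1 \<le> m" and tds: "tds X \<phi>"
    and eq: "equicontinuous_tds Y \<psi>" and \<pi>: "factor_map X \<phi> Y \<psi> \<pi>"
    and \<gamma>: "topomorphic_section m X \<phi> Y \<pi> \<gamma>"
  shows "mean_equicontinuous (m + 1) X \<phi>"
proof (rule ccontr)
  assume "\<not> mean_equicontinuous (m + 1) X \<phi>"
  then obtain \<epsilon> :: real where \<epsilon>: "0 < \<epsilon>"
    and bad: "\<And>\<delta>. 0 < \<delta> \<Longrightarrow> \<exists>x. (\<forall>i\<in>{1..m + 1}. x i \<in> X) \<and> D_max (m + 1) x < \<delta>
      \<and> \<not> D_mean (m + 1) \<phi> x < ereal \<epsilon>"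
    unfolding mean_equicontinuous_def by metis
  have "\<exists>x. (\<forall>i\<in>{1..m + 1}. x i \<in> X) \<and> D_max (m + 1) x < inverse (real (Suc n))
      \<and> \<not> D_mean (m + 1) \<phi> x < ereal \<epsilon>" for n
    by (rule bad) simp
  then obtain w where w: "\<And>n i. i \<in> {1..m + 1} \<Longrightarrow> w n i \<in> X"
    "\<And>n. D_max (m + 1) (w n) < inverse (real (Suc n))"
    "\<And>n. \<not> D_mean (m + 1) \<phi> (w n) < ereal \<epsilon>" by metis
  have "\<exists>N>n. \<epsilon> / 2 < (\<Sum>i<N. D_min (m + 1) (\<lambda>j. (\<phi> ^^ i) (w n j))) / real N" for n
    using frequently_large_average_if_D_mean_ge[OF w(3) \<epsilon>] .
  then obtain N where N: "\<And>n. n < N n"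
    "\<And>n. \<epsilon> / 2 < (\<Sum>i<N n. D_min (m + 1) (\<lambda>j. (\<phi> ^^ i) (w n j))) / real (N n)" by metis
  \<comment> \<open>The tuples are completed to sequences in \<open>X\<close>; \<open>D_min\<close> does not see the added entries.\<close>
  define x where "x n j = (if j \<in> {1..m + 1} then w n j else w n 1)" for n j
  have xX: "x n j \<in> X" for n j using w(1) by (auto simp: x_def)
  define Z :: "(nat \<Rightarrow> 'a) set" where "Z = {z. \<forall>j. z j \<in> X}"
  have Z: "compact Z" unfolding Z_def using tds by (intro compact_sequence_space) (simp add: tds_def)
  obtain r M where r: "strict_mono (r :: nat \<Rightarrow> nat)" and M: "prob_space M"
    "sets M = sets (restrict_space borel Z)"
    and conv: "\<And>f :: (nat \<Rightarrow> 'a) \<Rightarrow> real. continuous_on Z f \<Longrightarrow>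
       (\<lambda>n. (\<Sum>i<N (r n). f (\<lambda>j. (\<phi> ^^ i) (x (r n) j))) / real (N (r n))) \<longlonglongrightarrow> (LINT z|M. f z)"
    and inv: "\<And>j. invariant_measure X \<phi> (distr M (restrict_space borel X) (\<lambda>z. z j))"
    by (rule orbit_averages_weak_limit[of X \<phi> x N, OF tds xX N(1), folded Z_def]) (rule that)
  interpret M: prob_space M by (rule M(1))
  have spM: "space M = Z" using sets_eq_imp_space_eq[OF M(2)] by (simp add: space_restrict_space)
  have cj: "continuous_on S (\<lambda>z :: nat \<Rightarrow> 'a. z j)" for S j
    by (rule continuous_on_subset[OF continuous_on_product_coordinates]) simp
  have int: "integrable M f" if f: "continuous_on Z f" for f :: "(nat \<Rightarrow> 'a) \<Rightarrow> real"
  proof -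
    obtain B where "\<And>z. z \<in> Z \<Longrightarrow> norm (f z) \<le> B"
      using compact_imp_bounded[OF compact_continuous_image[OF f Z]] unfolding bounded_iff by auto
    moreover have "f \<in> borel_measurable M"
      unfolding measurable_cong_sets[OF M(2) refl] using f by (rule borel_measurable_continuous_on_restrict)
    ultimately show ?thesis by (intro M.integrable_const_bound[of _ B] AE_I2) (auto simp: spM)
  qed
  define \<Gamma> where "\<Gamma> = {\<gamma> y i | y i. y \<in> Y \<and> i \<in> {1..m}}"
  have in\<Gamma>: "AE z in M. z j \<in> \<Gamma>" for j
  proof -
    let ?\<mu> = "distr M (restrict_space borel X) (\<lambda>z. z j)"
    have one: "measure ?\<mu> \<Gamma> = 1"
      using \<gamma> inv[of j] unfolding topomorphic_section_def \<Gamma>_def by blast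
    then have "\<Gamma> \<in> sets (restrict_space borel X)" using measure_notin_sets[of \<Gamma> ?\<mu>] by fastforce
    moreover have "(\<lambda>z. z j) \<in> M \<rightarrow>\<^sub>M restrict_space borel X"
      unfolding measurable_cong_sets[OF M(2) refl]
      by (intro measurable_restrict_space2 borel_measurable_continuous_on_restrict cj)
        (auto simp: space_restrict_space Z_def)
    ultimately have "M.prob ((\<lambda>z. z j) -` \<Gamma> \<inter> space M) = 1" using one by (simp add: measure_distr)
    then show ?thesis by (auto dest: M.AE_prob_1)
  qed
  have same_fibre: "AE z in M. \<pi> (z i) = \<pi> (z j)" if ij: "i \<in> {1..m + 1}" "j \<in> {1..m + 1}" "i < j" for i j
  proof -
    let ?f = "\<lambda>z. dist (\<pi> (z i)) (\<pi> (z j))"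
    have "continuous_on Z (\<lambda>z. \<pi> (z l))" for l
    proof (rule continuous_on_compose2[OF _ cj])
      show "continuous_on X \<pi>" using \<pi> by (simp add: factor_map_def)
      show "(\<lambda>z. z l) ` Z \<subseteq> X" by (auto simp: Z_def)
    qed
    then have cf: "continuous_on Z ?f" by (intro continuous_on_dist)
    have "(\<lambda>n. (\<Sum>l<N n. ?f (\<lambda>j. (\<phi> ^^ l) (x n j))) / real (N n)) \<longlonglongrightarrow> 0"
    proof (rule LIMSEQ_I)
      fix \<eta> :: real assume "0 < \<eta>"
      then obtain \<delta> where \<delta>: "0 < \<delta>" "\<And>x y n. x \<in> X \<Longrightarrow> y \<in> X \<Longrightarrow> dist x y < \<delta> \<Longrightarrow>
          dist (\<pi> ((\<phi> ^^ n) x)) (\<pi> ((\<phi> ^^ n) y)) < \<eta>"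
        using orbits_uniformly_close_in_equicontinuous_factor[OF tds eq \<pi>] by metis
      obtain n0 where n0: "inverse (real (Suc n0)) < \<delta>" using reals_Archimedean[OF \<delta>(1)] by blast
      have "\<bar>(\<Sum>l<N n. ?f (\<lambda>j. (\<phi> ^^ l) (x n j))) / real (N n)\<bar> < \<eta>" if "n0 \<le> n" for n
      proof -
        have "dist (x n i) (x n j) \<le> D_max (m + 1) (w n)"
          using ij by (auto simp: x_def intro: dist_le_D_max)
        also have "\<dots> < inverse (real (Suc n))" by (rule w(2))
        also have "\<dots> \<le> inverse (real (Suc n0))" using that by (simp add: le_imp_inverse_le)
        also note n0
        finally have "?f (\<lambda>j. (\<phi> ^^ l) (x n j)) < \<eta>" for l by (intro \<delta>(2) xX)
        then have "(\<Sum>l<N n. ?f (\<lambda>j. (\<phi> ^^ l) (x n j))) < (\<Sum>l<N n. \<eta>)"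
          using N(1)[of n] by (intro sum_strict_mono) auto
        moreover have "0 \<le> (\<Sum>l<N n. ?f (\<lambda>j. (\<phi> ^^ l) (x n j)))" by (intro sum_nonneg) simp
        ultimately show ?thesis using N(1)[of n] by (simp add: divide_simps mult.commute)
      qed
      then show "\<exists>n0. \<forall>n\<ge>n0. norm ((\<Sum>l<N n. ?f (\<lambda>j. (\<phi> ^^ l) (x n j))) / real (N n) - 0) < \<eta>"
        by (intro exI[of _ n0]) simp
    qed
    from LIMSEQ_subseq_LIMSEQ[OF this r] have "(LINT z|M. ?f z) = 0"
      by (intro LIMSEQ_unique[OF conv[OF cf]]) (simp add: o_def)
    then show ?thesis using integral_nonneg_eq_0_iff_AE[OF int[OF cf]] by simp
  qed
  have "AE z in M. \<forall>i\<in>{1..m + 1}. z i \<in> \<Gamma>"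
    using in\<Gamma> by (intro AE_finite_allI) auto
  moreover have "AE z in M. \<forall>i\<in>{2..m + 1}. \<pi> (z 1) = \<pi> (z i)"
    using same_fibre by (intro AE_finite_allI) auto
  ultimately have neg: "AE z in M. D_min (m + 1) z \<le> 0"
  proof eventually_elim
    case (elim z)
    have "\<exists>l\<in>{1..m}. z i = \<gamma> (\<pi> (z 1)) l" if i: "i \<in> {1..m + 1}" for i
    proof -
      have "z i \<in> \<Gamma>" using elim(1) i by blast
      then obtain y l where yl: "z i = \<gamma> y l" "y \<in> Y" "l \<in> {1..m}" unfolding \<Gamma>_def by blast
      then have "\<pi> (z i) = y" using \<gamma> by (auto simp: topomorphic_section_def)
      moreover have "\<pi> (z 1) = \<pi> (z i)" using elim(2) i by (cases "i = 1") auto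
      ultimately show ?thesis using yl by auto
    qed
    then show ?case by (rule D_min_nonpos_if_few_values)
  qed
  have cD: "continuous_on Z (D_min (m + 1))" by (rule continuous_on_D_min) (use m in simp)
  have "(LINT z|M. D_min (m + 1) z) \<le> (LINT z|M. 0)"
    by (rule integral_mono_AE[OF int[OF cD] integrable_zero neg])
  moreover have "\<epsilon> / 2 \<le> (LINT z|M. D_min (m + 1) z)"
  proof (rule LIMSEQ_le_const[OF conv[OF cD]])
    have same: "D_min (m + 1) (\<lambda>j. (\<phi> ^^ i) (x n j)) = D_min (m + 1) (\<lambda>j. (\<phi> ^^ i) (w n j))" for n i
      by (rule D_min_cong) (auto simp: x_def)
    show "\<exists>n0. \<forall>n\<ge>n0. \<epsilon> / 2 \<le> (\<Sum>i<N (r n). D_min (m + 1) (\<lambda>j. (\<phi> ^^ i) (x (r n) j))) / real (N (r n))"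
    proof (intro exI allI impI)
      fix n
      show "\<epsilon> / 2 \<le> (\<Sum>i<N (r n). D_min (m + 1) (\<lambda>j. (\<phi> ^^ i) (x (r n) j))) / real (N (r n))"
        unfolding same using N(2)[of "r n"] by (rule less_imp_le)
    qed
  qed
  ultimately show False using \<epsilon> unfolding integral_zero by linarith
qed

theorem theorem1p1:
  fixes X :: "'a::metric_space set" and \<phi> :: "'a \<Rightarrow> 'a"
    and Y :: "'b::metric_space set" and \<psi> :: "'b \<Rightarrow> 'b"
    and \<pi> :: "'a \<Rightarrow> 'b" and m :: nat
  assumes "m \<ge> 1"
    and "minimal_tds X \<phi>"
    and "maximal_equicontinuous_factor X \<phi> Y \<psi> \<pi>"
    and "topomorphic_extension m X \<phi> Y \<pi>"
  shows "mean_equicontinuous (m + 1) X \<phi>"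
proof -
  note tds = assms(2)[unfolded minimal_tds_def, THEN conjunct1]
  note eq = assms(3)[unfolded maximal_equicontinuous_factor_def, THEN conjunct1]
  note fm = assms(3)[unfolded maximal_equicontinuous_factor_def, THEN conjunct2, THEN conjunct1]
  from assms(4) obtain \<gamma> where "topomorphic_section m X \<phi> Y \<pi> \<gamma>"
    unfolding topomorphic_extension_def by (elim conjE exE)
  then show ?thesis by (rule topomorphic_section_imp_mean_equicontinuous[OF assms(1) tds eq fm])
qed

end
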